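(* Let $S$ be a finite symmetric N-step set, i.e. $-s:=\{-a: a\in s\}\in S$ for every $s\in S$, with weights $p_s$. Then the generating function $D^+(0,1;t)$ of N-excursions on $S$ is symmetric in $p_s$ and $p_{-s}$ for all $s\in S$: it is unchanged by the substitution exchanging $p_s$ and $p_{-s}$ for every $s\in S$.
   Context: An N-step is a non-empty finite set of integers. For a finite set $S$ of N-steps with weights $p_s$, an N-walk is a finite sequence $(s_1,\dots,s_n)$ of elements of $S$, starting at $0$, with weight $\prod_i p_{s_i}$. A classical walk $(v_1,\dots,v_n)$ with positions $\omega_k=\sum_{i\le k}v_i$ is compatible if $v_i\in s_i$ for all $i$; it is an excursion if all $\omega_k\ge0$ and $\omega_n=0$. An N-excursion is an N-walk compatible with at least one excursion. $D^+(0,1;t)=\sum_w(\prod_ip_{s_i})t^{|w|}$ over N-excursions $w$. *)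

theory Defs
  imports "HOL-Computational_Algebra.Formal_Power_Series"
begin

definition N_step :: "int set \<Rightarrow> bool" where
  "N_step s \<longleftrightarrow> finite s \<and> s \<noteq> {}"

definition neg_step :: "int set \<Rightarrow> int set" where
  "neg_step s = uminus ` s"

definition N_step_set :: "int set set \<Rightarrow> bool" where
  "N_step_set S \<longleftrightarrow> finite S \<and> (\<forall>s\<in>S. N_step s)"

definition symmetric_N_step_set :: "int set set \<Rightarrow> bool" where
  "symmetric_N_step_set S \<longleftrightarrow> N_step_set S \<and> (\<forall>s\<in>S. neg_step s \<in> S)"

text \<open>Walks are lists of steps; the empty walk (length 0) is included.\<close>

definition N_walk :: "int set set \<Rightarrow> int set list \<Rightarrow> bool" where
  "N_walk S w \<longleftrightarrow> set w \<subseteq> S"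

definition walk_weight :: "(int set \<Rightarrow> 'a::comm_semiring_1) \<Rightarrow> int set list \<Rightarrow> 'a" where
  "walk_weight p w = (\<Prod>s\<leftarrow>w. p s)"

definition position :: "int list \<Rightarrow> nat \<Rightarrow> int" where
  "position v k = (\<Sum>i<k. v ! i)"

definition excursion :: "int list \<Rightarrow> bool" where
  "excursion v \<longleftrightarrow> (\<forall>k\<le>length v. position v k \<ge> 0) \<and> position v (length v) = 0"

definition compatible :: "int list \<Rightarrow> int set list \<Rightarrow> bool" where
  "compatible v w \<longleftrightarrow> length v = length w \<and> (\<forall>i<length w. v ! i \<in> w ! i)"

definition N_excursion :: "int set set \<Rightarrow> int set list \<Rightarrow> bool" where
  "N_excursion S w \<longleftrightarrow> N_walk S w \<and> (\<exists>v. compatible v w \<and> excursion v)"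

text \<open>
  The generating function \<open>D\<^sup>+(0,1;t)\<close>, as a formal power series in \<open>t\<close>. The sum over all
  N-excursions is taken coefficientwise; for finite \<open>S\<close> each coefficient is a finite sum.
  The weights lie in an arbitrary commutative semiring, so they may be numbers or
  indeterminates of a polynomial ring.
\<close>

definition D_plus :: "int set set \<Rightarrow> (int set \<Rightarrow> 'a::comm_semiring_1) \<Rightarrow> 'a fps" where
  "D_plus S p = Abs_fps (\<lambda>n. \<Sum>w | N_excursion S w \<and> length w = n. walk_weight p w)"

end

theory Submission
  imports Defs
begin

text \<open>
  Reversing time and negating all steps turns an excursion with positions \<open>\<omega>\<^sub>k\<close> into one with
  positions \<open>\<omega>\<^sub>n\<^sub>-\<^sub>k\<close>. Lifted to N-walks, this is a length-preserving involution on N-excursions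
  which exchanges the weights of \<open>s\<close> and \<open>-s\<close>.
\<close>

definition reflect :: "int set list \<Rightarrow> int set list" where
  "reflect w = rev (map neg_step w)"

lemma neg_step_neg_step [simp]: "neg_step (neg_step s) = s"
  by (simp add: neg_step_def image_image)

lemma length_reflect [simp]: "length (reflect w) = length w"
  by (simp add: reflect_def)

lemma reflect_reflect [simp]: "reflect (reflect w) = w"
  by (simp add: reflect_def rev_map comp_def)

lemma position_eq_sum_list_take:
  assumes "k \<le> length v"
  shows "position v k = sum_list (take k v)"
  using assms by (simp add: position_def sum_list_sum_nth atLeast0LessThan min_absorb2)

lemma sum_list_map_uminus: "sum_list (map uminus v) = - sum_list v"
  for v :: "int list"
  by (induction v) auto

text \<open>The first \<open>k\<close> entries of the reversed list are the last \<open>k\<close>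
  entries of \<open>v\<close>, negated. Their sum is minus what \<open>v\<close> still gains after
  its first \<open>length v - k\<close> steps.\<close>

lemma position_rev_uminus:
  assumes "k \<le> length v"
  shows "position (rev (map uminus v)) k = position v (length v - k) - position v (length v)"
proof -
  have "sum_list v = sum_list (take (length v - k) v) + sum_list (drop (length v - k) v)"
    by (metis append_take_drop_id sum_list_append)
  then show ?thesis
    using assms
    by (simp add: position_eq_sum_list_take take_rev drop_map sum_list_rev sum_list_map_uminus)
qed

lemma excursion_rev_uminus:
  assumes "excursion v"
  shows "excursion (rev (map uminus v))"
  \<comment> \<open>The subtracted final position is 0, so nonnegativity carries over; the endpoint
    condition reduces to the empty sum \<open>position v 0 = 0\<close>.\<close>
  using assms by (auto simp: excursion_def position_rev_uminus) (simp add: position_def)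

lemma compatible_reflect:
  assumes "compatible v w"
  shows "compatible (rev (map uminus v)) (reflect w)"
  using assms by (auto simp: compatible_def reflect_def rev_nth neg_step_def)

lemma N_excursion_reflect:
  assumes "symmetric_N_step_set S" and "N_excursion S w"
  shows "N_excursion S (reflect w)"
proof -
  obtain v where v: "compatible v w" "excursion v"
    using assms(2) by (auto simp: N_excursion_def)
  have "N_walk S (reflect w)"
    using assms by (auto simp: N_excursion_def N_walk_def symmetric_N_step_set_def reflect_def)
  then show ?thesis
    using compatible_reflect[OF v(1)] excursion_rev_uminus[OF v(2)]
    by (auto simp: N_excursion_def)
qed

text \<open>Reversal does not affect the product, as the weights commute.\<close>

lemma walk_weight_reflect:
  "walk_weight p (reflect w) = walk_weight (\<lambda>s. p (neg_step s)) w"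
  by (induction w) (simp_all add: walk_weight_def reflect_def mult.commute)

theorem theorem5p3:
  fixes S :: "int set set" and p :: "int set \<Rightarrow> 'a::comm_semiring_1"
  assumes "symmetric_N_step_set S"
  shows "D_plus S (\<lambda>s. p (neg_step s)) = D_plus S p"
proof -
  have "(\<Sum>w | N_excursion S w \<and> length w = n. walk_weight (\<lambda>s. p (neg_step s)) w) =
    (\<Sum>w | N_excursion S w \<and> length w = n. walk_weight p w)" for n
    \<comment> \<open>Being its own inverse, \<open>reflect\<close> is the witness in both
      directions; it preserves length, hence acts within each coefficient.\<close>
    by (rule sum.reindex_bij_witness[of _ reflect reflect])
      (use N_excursion_reflect[OF assms] in \<open>auto simp: walk_weight_reflect\<close>)
  then show ?thesis
    by (simp add: D_plus_def)
qed

end
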